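(* Let $A$ be a finite alphabet and let $\mu$ be a probability distribution on $A$. Let $x^*=x_1x_2\dots$ be a sequence of i.i.d. random variables with distribution $\mu$ on $A$ (the covertext), and let $y^*=y_1y_2\dots$ be a sequence of i.i.d. random variables uniform on $\{0,1\}$ (the hidden text), independent of $x^*$. For each integer $n>1$ let $L_n$ be the average number of hidden symbols per covertext letter when the stegosystem $St_n(A)$ is applied to $x^*$ and $y^*$. Then $$\lim_{n\to\infty}L_n=h(\mu),\qquad h(\mu)=-\sum_{a\in A}\mu(a)\log\mu(a).$$
   Context: All logarithms are to base $2$, and $0\log 0=0$. For a word $u\in A^n$ and $a\in A$ let $\nu_u(a)$ be the number of occurrences of $a$ in $u$, and let $$S_u=\{v\in A^n:\ \forall a\in A\ \ \nu_v(a)=\nu_u(a)\}.$$ For each such set fix an enumeration $S_u=\{s_0,s_1,\dots,s_{|S_u|-1}\}$ (for example lexicographical) depending only on the set $S_u$. Put $m=\lfloor\log_2|S_u|\rfloor$ and write the binary expansion $|S_u|=\sum_{i=0}^m\alpha_i2^i$ with $\alpha_i\in\{0,1\}$, $\alpha_m=1$. The stegosystem $St_n(A)$: the sequence $x^*$ is split into consecutive blocks of length $n$, which are processed in order. For a block $u$, a value $d$ of a random variable $\Delta$ is generated, where $$p(\Delta=i)=\frac{\alpha_i2^i}{|S_u|},\qquad i\in\{0,1,\dots,m\};$$ given the blocks, the values of $\Delta$ for different blocks are generated independently of each other and of $y^*$. Then the next $d$ not yet used symbols of $y^*$ are read (and used up); regarded as a binary representation of length $d$, they give an integer $r\in\{0,\dots,2^d-1\}$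 (with $r=0$ if $d=0$). The corresponding output block of length $n$ is $s_\tau\in S_u$, where $$\tau=\sum_{l=d+1}^m\alpha_l2^l+r.$$ The average number of hidden symbols per covertext letter, $L_n$, is the expected number of symbols of $y^*$ used up in the processing of one block, divided by $n$. *)

theory Defs
  imports "HOL-Probability.Probability"
begin

definition perm_class :: "'a list \<Rightarrow> 'a list set" where
  "perm_class u = {v. length v = length u \<and> (\<forall>a. count_list v a = count_list u a)}"

definition top_exp :: "'a list set \<Rightarrow> nat" where
  "top_exp S = nat \<lfloor>log 2 (real (card S))\<rfloor>"

definition bin_digit :: "'a list set \<Rightarrow> nat \<Rightarrow> nat" where
  "bin_digit S i = of_bool (bit (card S) i)"

definition delta_prob :: "'a list set \<Rightarrow> nat \<Rightarrow> real" where
  "delta_prob S i =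
     (if i \<le> top_exp S then real (bin_digit S i) * 2 ^ i / real (card S) else 0)"

text \<open>Binary words are read with the most significant bit first, whereas
  \<^const>\<open>horner_sum\<close> takes the least significant digit first.\<close>

definition bits_value :: "bool list \<Rightarrow> nat" where
  "bits_value w = horner_sum of_bool 2 (rev w)"

definition word_index :: "'a list set \<Rightarrow> bool list \<Rightarrow> nat" where
  "word_index S w =
     (\<Sum>l = length w + 1..top_exp S. bin_digit S l * 2 ^ l) + bits_value w"

definition block :: "nat \<Rightarrow> (nat \<Rightarrow> 'a) \<Rightarrow> nat \<Rightarrow> 'a list" where
  "block n x k = map x [n * k..<n * Suc k]"

text \<open>The argument \<open>enum\<close> gives, for each set \<open>S\<close> of words, the enumeration
  \<open>enum S 0, enum S 1, \<dots>\<close> of \<open>S\<close>; \<open>d k\<close> is the value of \<open>\<Delta>\<close> generated for the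
  block with index \<open>k\<close>. After \<open>k\<close> blocks the state consists of the output blocks
  so far and the number of hidden symbols used up so far. Sequences are indexed from 0.\<close>

primrec steg_run ::
  "('a list set \<Rightarrow> nat \<Rightarrow> 'a list) \<Rightarrow> nat \<Rightarrow> (nat \<Rightarrow> 'a) \<Rightarrow> (nat \<Rightarrow> bool) \<Rightarrow> (nat \<Rightarrow> nat)
    \<Rightarrow> nat \<Rightarrow> 'a list list \<times> nat" where
  "steg_run enum n x y d 0 = ([], 0)"
| "steg_run enum n x y d (Suc k) =
     (let (out, p) = steg_run enum n x y d k;
          S = perm_class (block n x k);
          w = map y [p..<p + d k]
      in (out @ [enum S (word_index S w)], p + length w))"

definition hidden_used ::
  "('a list set \<Rightarrow> nat \<Rightarrow> 'a list) \<Rightarrow> nat \<Rightarrow> (nat \<Rightarrow> 'a) \<Rightarrow> (nat \<Rightarrow> bool) \<Rightarrow> (nat \<Rightarrow> nat)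
    \<Rightarrow> nat \<Rightarrow> nat" where
  "hidden_used enum n x y d k =
     snd (steg_run enum n x y d (Suc k)) - snd (steg_run enum n x y d k)"

definition avg_hidden ::
  "'w measure \<Rightarrow> ('a list set \<Rightarrow> nat \<Rightarrow> 'a list) \<Rightarrow> nat \<Rightarrow> (nat \<Rightarrow> 'w \<Rightarrow> 'a)
    \<Rightarrow> (nat \<Rightarrow> 'w \<Rightarrow> bool) \<Rightarrow> (nat \<Rightarrow> 'w \<Rightarrow> nat) \<Rightarrow> nat \<Rightarrow> real" where
  "avg_hidden M enum n X Y D k =
     prob_space.expectation M
       (\<lambda>\<omega>. real (hidden_used enum n (\<lambda>i. X i \<omega>) (\<lambda>i. Y i \<omega>) (\<lambda>i. D i \<omega>) k)) / real n"

text \<open>Given the blocks of length \<open>n\<close>, the values \<open>D 0, D 1, \<dots>\<close> are independent of each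
  other and of the hidden text, and \<open>D j\<close> has the law \<^const>\<open>delta_prob\<close> determined by
  block \<open>j\<close>. Conditioning on any number \<open>K\<close> of initial blocks determines the
  conditional law given the whole covertext. The guard excludes conditioning on null
  events, where \<^const>\<open>cond_prob\<close> is 0 by convention.\<close>

definition steg_delta ::
  "'w measure \<Rightarrow> nat \<Rightarrow> (nat \<Rightarrow> 'w \<Rightarrow> 'a) \<Rightarrow> (nat \<Rightarrow> 'w \<Rightarrow> bool) \<Rightarrow> (nat \<Rightarrow> 'w \<Rightarrow> nat) \<Rightarrow> bool" where
  "steg_delta M n X Y D \<longleftrightarrow>
     (\<forall>j. D j \<in> measurable M (count_space UNIV)) \<and>
     (\<forall>K u d. \<forall>B \<in> sets (PiM UNIV (\<lambda>_. count_space UNIV)).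
        \<P>(\<omega> in M. \<forall>j<K. block n (\<lambda>i. X i \<omega>) j = u j) \<noteq> 0 \<longrightarrow>
        \<P>(\<omega> in M. (\<forall>j<K. D j \<omega> = d j) \<and> (\<lambda>i. Y i \<omega>) \<in> B
            \<bar> \<forall>j<K. block n (\<lambda>i. X i \<omega>) j = u j) =
        (\<Prod>j<K. delta_prob (perm_class (u j)) (d j)) * \<P>(\<omega> in M. (\<lambda>i. Y i \<omega>) \<in> B))"

definition shannon :: "'a::finite pmf \<Rightarrow> real" where
  "shannon \<mu> = - (\<Sum>a\<in>UNIV. pmf \<mu> a * log 2 (pmf \<mu> a))"

end

theory Submission
  imports Defs "HOL-Real_Asymp.Real_Asymp"
begin

text \<open>Given a block \<open>u\<close>, the mean of \<open>\<Delta>\<close> is within 3 of \<open>log |S\<^sub>u|\<close>, since the top binary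
  digits of \<open>|S\<^sub>u|\<close> carry almost all of the mass. So \<open>n L\<^sub>n\<close> is \<open>E log |S\<^sub>u|\<close> up to a bounded
  error. All words of \<open>S\<^sub>u\<close> have the same probability \<open>P(u)\<close>, hence
  \<open>E log |S\<^sub>u| = E (- log P(u)) + E log P(S\<^sub>u) = n h(\<mu>) - H(type of u)\<close>, and the entropy of the
  type lies between 0 and \<open>|A| log (n + 1)\<close>, because there are at most \<open>(n + 1) ^ |A|\<close> types.\<close>

section \<open>The mean of \<open>\<Delta>\<close>\<close>

lemma sum_bits_eq:
  fixes N :: nat
  assumes "N < 2 ^ Suc m"
  shows "(\<Sum>i\<le>m. of_bool (bit N i) * 2 ^ i) = N"
proof -
  have "(\<Sum>i\<le>m. of_bool (bit N i) * 2 ^ i) = take_bit (Suc m) N"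
    by (simp add: take_bit_sum push_bit_eq_mult atLeast0LessThan lessThan_Suc_atMost)
  with assms show ?thesis
    by (simp add: take_bit_nat_eq_self)
qed

lemma top_exp_bounds:
  assumes "card S > 0"
  shows "2 ^ top_exp S \<le> card S" "card S < 2 ^ Suc (top_exp S)"
proof -
  define L where "L = log 2 (real (card S))"
  have L: "2 powr L = real (card S)" "L \<ge> 0"
    using assms by (auto simp: L_def)
  \<comment> \<open>Since \<open>L\<close> is nonnegative, the conversion by \<open>nat\<close> in
    \<open>top_exp\<close> does not truncate.\<close>
  have m: "real (top_exp S) \<le> L" "L < real (Suc (top_exp S))"
    using L(2) unfolding top_exp_def L_def[symmetric] by linarith+
  have "2 powr real (top_exp S) \<le> real (card S)" "real (card S) < 2 powr real (Suc (top_exp S))"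
    using m L(1) by (metis one_less_numeral_iff powr_le_cancel_iff semiring_norm(76),
                     metis one_less_numeral_iff powr_less_cancel_iff semiring_norm(76))
  then have "real (2 ^ top_exp S) \<le> real (card S)" "real (card S) < real (2 ^ Suc (top_exp S))"
    unfolding powr_realpow[OF zero_less_numeral] by simp_all
  then show "2 ^ top_exp S \<le> card S" "card S < 2 ^ Suc (top_exp S)"
    unfolding of_nat_le_iff of_nat_less_iff by blast+
qed

lemma delta_prob_nonneg: "delta_prob S i \<ge> 0"
  by (simp add: delta_prob_def)

lemma sum_bin_digit:
  assumes "card S > 0"
  shows "(\<Sum>i\<le>top_exp S. real (bin_digit S i) * 2 ^ i) = real (card S)"
proof -
  have "(\<Sum>i\<le>top_exp S. real (bin_digit S i) * 2 ^ i)
      = real (\<Sum>i\<le>top_exp S. of_bool (bit (card S) i) * 2 ^ i)"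
    unfolding of_nat_sum by (intro sum.cong) (auto simp: bin_digit_def)
  also have "\<dots> = real (card S)"
    using sum_bits_eq[OF top_exp_bounds(2)[OF assms]] by presburger
  finally show ?thesis .
qed

lemma sum_delta_prob:
  assumes "card S > 0"
  shows "(\<Sum>i\<le>top_exp S. delta_prob S i) = 1"
  using sum_bin_digit[OF assms] assms
  by (simp add: delta_prob_def sum_divide_distrib[symmetric])

text \<open>With every binary digit set to 1, this is the numerator of the mean shortfall of
  \<Delta> below the top exponent.\<close>

lemma sum_diff_mult_power2:
  "(\<Sum>i\<le>m. (real m - real i) * 2 ^ i) = 2 ^ Suc m - real m - 2"
proof (induction m)
  case (Suc m)
  \<comment> \<open>Raising the exponent by one adds 1 to each coefficient, and the new summand at
    \<open>Suc m\<close> has coefficient 0.\<close>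
  have "(\<Sum>i\<le>m. (real (Suc m) - real i) * 2 ^ i)
      = (\<Sum>i\<le>m. (real m - real i) * 2 ^ i) + (\<Sum>i\<le>m. 2 ^ i)"
    unfolding sum.distrib[symmetric] by (intro sum.cong) (auto simp: algebra_simps)
  moreover have "(\<Sum>i\<le>m. (2::real) ^ i) = 2 ^ Suc m - 1"
    by (induction m) auto
  ultimately show ?case
    using Suc by simp
qed simp

definition delta_mean :: "'a list set \<Rightarrow> real" where
  "delta_mean S = (\<Sum>i\<le>top_exp S. delta_prob S i * real i)"

text \<open>\<Delta> never exceeds \<open>top_exp S\<close>, the floor of the logarithm.\<close>

lemma delta_mean_le_log:
  assumes "card S > 0"
  shows "delta_mean S \<le> log 2 (real (card S))"
proof -
  have "delta_mean S \<le> (\<Sum>i\<le>top_exp S. delta_prob S i * real (top_exp S))"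
    unfolding delta_mean_def by (intro sum_mono mult_left_mono) (auto simp: delta_prob_nonneg)
  also have "\<dots> = real (top_exp S)"
    by (simp add: sum_distrib_right[symmetric] sum_delta_prob[OF assms])
  also have "\<dots> = log 2 (2 ^ top_exp S)"
    by (simp add: log_nat_power)
  also have "\<dots> \<le> log 2 (real (card S))"
    using top_exp_bounds(1)[OF assms] assms
    by (subst log_le_cancel_iff) (auto simp flip: of_nat_le_iff)
  finally show ?thesis .
qed

text \<open>The mean falls short of the top exponent by at most 2, and rounding the logarithm down
  loses at most 1 more.\<close>

lemma log_le_delta_mean:
  assumes "card S > 0"
  shows "log 2 (real (card S)) - 3 \<le> delta_mean S"
proof -
  define m where "m = top_exp S"
  note b = top_exp_bounds[OF assms, folded m_def]
  have "real m - delta_mean S = (\<Sum>i\<le>m. delta_prob S i * (real m - real i))"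
    using sum_delta_prob[OF assms]
    by (simp add: delta_mean_def m_def right_diff_distrib sum_subtractf sum_distrib_right[symmetric])
  \<comment> \<open>The coefficients \<open>m - i\<close> are nonnegative, so each binary digit may
    be replaced by 1.\<close>
  also have "\<dots> \<le> (\<Sum>i\<le>m. (real m - real i) * 2 ^ i / real (card S))"
    by (intro sum_mono)
      (auto simp: delta_prob_def m_def bin_digit_def of_bool_def intro!: divide_right_mono)
  also have "\<dots> = (2 ^ Suc m - real m - 2) / real (card S)"
    by (simp only: sum_divide_distrib[symmetric] sum_diff_mult_power2)
  also have "\<dots> \<le> (2 * 2 ^ m) / 2 ^ m"
    using b(1) by (intro frac_le) (auto simp flip: of_nat_le_iff)
  finally have "real m - delta_mean S \<le> 2"
    by simp
  moreover have "log 2 (real (card S)) \<le> log 2 (2 ^ Suc m)"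
    using of_nat_mono[OF less_imp_le[OF b(2)], where 'a = real] assms
    by (subst log_le_cancel_iff) auto
  then have "log 2 (real (card S)) \<le> real m + 1"
    by (simp only: log_pow_cancel)
  ultimately show ?thesis
    by linarith
qed

section \<open>Entropy of an i.i.d. word and of its type\<close>

definition words :: "nat \<Rightarrow> 'a list set" where
  "words n = {u. length u = n}"

definition word_prob :: "'a pmf \<Rightarrow> 'a list \<Rightarrow> real" where
  "word_prob \<mu> u = prod_list (map (pmf \<mu>) u)"

lemma words_0: "words 0 = {[]}"
  by (auto simp: words_def)

lemma finite_words: "finite (words n :: 'a::finite list set)"
  using finite_lists_length_eq[of "UNIV :: 'a set" n] by (simp add: words_def)

lemma sum_words_Suc:
  fixes f :: "'a::finite list \<Rightarrow> 'b::comm_monoid_add"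
  shows "sum f (words (Suc n)) = (\<Sum>a\<in>UNIV. \<Sum>u\<in>words n. f (a # u))"
proof -
  have eq: "words (Suc n) = (\<lambda>(a, u). a # u) ` (UNIV \<times> (words n :: 'a list set))"
    by (auto simp: words_def length_Suc_conv)
  show ?thesis
    unfolding eq by (subst sum.reindex) (auto simp: inj_on_def sum.cartesian_product case_prod_unfold)
qed

lemma word_prob_Cons: "word_prob \<mu> (a # u) = pmf \<mu> a * word_prob \<mu> u"
  by (simp add: word_prob_def)

lemma word_prob_nonneg: "word_prob \<mu> u \<ge> 0"
  by (induction u) (auto simp: word_prob_def)

lemma word_prob_eq_prod: "word_prob \<mu> u = (\<Prod>i<length u. pmf \<mu> (u ! i))"
  by (simp add: word_prob_def prod.list_conv_set_nth atLeast0LessThan)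

lemma sum_word_prob:
  fixes \<mu> :: "'a::finite pmf"
  shows "sum (word_prob \<mu>) (words n) = 1"
proof (induction n)
  case (Suc n)
  then show ?case
    by (simp add: sum_words_Suc word_prob_Cons sum_distrib_left[symmetric] sum_pmf_eq_1)
qed (simp add: words_0 word_prob_def)

text \<open>Entropy is additive over independent letters: once the first letter is split off, the
  logarithm of the product becomes a letter term plus a word term, and each is averaged
  separately.\<close>

lemma sum_word_prob_log:
  fixes \<mu> :: "'a::finite pmf"
  shows "(\<Sum>u\<in>words n. word_prob \<mu> u * log 2 (word_prob \<mu> u)) = - real n * shannon \<mu>"
proof (induction n)
  case (Suc n)
  have *: "word_prob \<mu> (a # u) * log 2 (word_prob \<mu> (a # u)) =
      (pmf \<mu> a * log 2 (pmf \<mu> a)) * word_prob \<mu> u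
      + pmf \<mu> a * (word_prob \<mu> u * log 2 (word_prob \<mu> u))" for a u
  \<comment> \<open>The logarithm splits only for positive factors. If a factor is 0, it occurs in
    every summand, so both sides vanish whatever the value of \<open>log 2 0\<close>.\<close>
  proof (cases "pmf \<mu> a = 0 \<or> word_prob \<mu> u = 0")
    case False
    then have "pmf \<mu> a > 0" "word_prob \<mu> u > 0"
      using word_prob_nonneg[of \<mu> u] by (auto simp: less_le)
    then show ?thesis
      by (simp add: word_prob_Cons log_mult algebra_simps)
  qed (auto simp: word_prob_Cons)
  show ?case
    unfolding sum_words_Suc * sum.distrib sum_distrib_left[symmetric] sum_distrib_right[symmetric]
      sum_word_prob Suc
    by (simp add: shannon_def sum_pmf_eq_1 algebra_simps)
qed (simp add: words_0 word_prob_def)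

section \<open>Permutation classes and the number of types\<close>

lemma perm_class_iff_mset: "v \<in> perm_class u \<longleftrightarrow> mset v = mset u"
  by (auto simp: perm_class_def multiset_eq_iff count_mset dest: mset_eq_length)
   (metis count_mset multiset_eq_iff size_mset)

lemma finite_perm_class: "finite (perm_class u)" for u :: "'a::finite list"
  by (rule finite_subset[OF _ finite_words[of "length u"]]) (auto simp: perm_class_def words_def)

lemma card_perm_class_pos: "card (perm_class u) > 0" for u :: "'a::finite list"
  using finite_perm_class[of u] by (auto simp: card_gt_0_iff perm_class_def)

text \<open>The probability of a word is a product over its multiset of letters.\<close>

lemma word_prob_perm_class:
  assumes "v \<in> perm_class u"
  shows "word_prob \<mu> v = word_prob \<mu> u"
  using assms unfolding perm_class_iff_mset word_prob_def
  by (metis mset_map prod_mset_prod_list)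

text \<open>The left side is the probability of the whole class, because its words are equally
  likely.\<close>

lemma word_prob_card_perm_class_le:
  fixes \<mu> :: "'a::finite pmf"
  shows "word_prob \<mu> u * real (card (perm_class u)) \<le> 1"
proof -
  have "word_prob \<mu> u * real (card (perm_class u)) = sum (word_prob \<mu>) (perm_class u)"
    by (simp add: word_prob_perm_class)
  also have "\<dots> \<le> sum (word_prob \<mu>) (words (length u))"
    by (intro sum_mono2 finite_words word_prob_nonneg) (auto simp: perm_class_def words_def)
  finally show ?thesis
    by (simp add: sum_word_prob)
qed

text \<open>Each class contributes exactly 1, so the sum counts the types of words of length
  \<open>n\<close>. A type is a map from letters to counts in \<open>{..n}\<close>; bounding all
  such maps ignores that the counts add up to \<open>n\<close>.\<close>

lemma sum_inverse_card_perm_class: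
  "(\<Sum>u\<in>words n. 1 / real (card (perm_class (u :: 'a::finite list)))) \<le> real (n + 1) ^ CARD('a)"
proof -
  define c :: "'a list \<Rightarrow> 'a \<Rightarrow> nat" where "c = count_list"
  have fibre: "{v \<in> words n. c v = c u} = perm_class u" if "u \<in> words n" for u
    using that by (auto simp: perm_class_def words_def c_def fun_eq_iff)
  have "(\<Sum>u\<in>words n. 1 / real (card (perm_class (u :: 'a list))))
      = (\<Sum>t\<in>c ` words n. \<Sum>u\<in>{u \<in> words n. c u = t}. 1 / real (card (perm_class u)))"
    by (rule sum.image_gen[OF finite_words])
  also have "\<dots> = (\<Sum>t\<in>c ` words n. 1)"
  proof (rule sum.cong[OF refl])
    fix t assume "t \<in> c ` words n"
    then obtain v where v: "v \<in> words n" "t = c v"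
      by auto
    \<comment> \<open>The summand is constant on a fibre, with value the inverse of the size of that
      fibre.\<close>
    have "perm_class u = perm_class v" if "u \<in> perm_class v" for u
      using that by (auto simp: perm_class_iff_mset)
    then show "(\<Sum>u\<in>{u \<in> words n. c u = t}. 1 / real (card (perm_class u))) = 1"
      using card_perm_class_pos[of v] unfolding v(2) fibre[OF v(1)] by simp
  qed
  also have "\<dots> \<le> real (card (UNIV \<rightarrow>\<^sub>E {..n} :: ('a \<Rightarrow> nat) set))"
    unfolding sum_constant
    by (simp, intro card_mono finite_PiE)
       (auto simp: c_def words_def count_le_length)
  also have "\<dots> = real (n + 1) ^ CARD('a)"
    by (simp add: card_PiE)
  finally show ?thesis .
qed

text \<open>A class has probability at most 1, so the logarithm of its size is at most
  \<open>- log 2 (word_prob \<mu> u)\<close>, whose mean is the entropy of the word.\<close>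

lemma sum_word_prob_log_card_le:
  fixes \<mu> :: "'a::finite pmf"
  shows "(\<Sum>u\<in>words n. word_prob \<mu> u * log 2 (real (card (perm_class u)))) \<le> real n * shannon \<mu>"
proof -
  have "word_prob \<mu> u * log 2 (real (card (perm_class u))) \<le> - (word_prob \<mu> u * log 2 (word_prob \<mu> u))"
    for u :: "'a list"
  proof (cases "word_prob \<mu> u = 0")
    case False
    then have pos: "word_prob \<mu> u > 0"
      using word_prob_nonneg[of \<mu> u] by simp
    have "log 2 (word_prob \<mu> u * real (card (perm_class u))) \<le> 0"
      using word_prob_card_perm_class_le[of \<mu> u] pos card_perm_class_pos[of u] by simp
    then have "log 2 (real (card (perm_class u))) \<le> - log 2 (word_prob \<mu> u)"
      using pos card_perm_class_pos[of u] by (simp add: log_mult)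
    from mult_left_mono[OF this word_prob_nonneg[of \<mu> u]] show ?thesis
      by simp
  qed simp
  then have "(\<Sum>u\<in>words n. word_prob \<mu> u * log 2 (real (card (perm_class u))))
      \<le> (\<Sum>u\<in>words n. - (word_prob \<mu> u * log 2 (word_prob \<mu> u)))"
    by (intro sum_mono)
  then show ?thesis
    by (simp add: sum_negf sum_word_prob_log)
qed

text \<open>Gibbs' inequality against the uniform distribution on types, summed over words rather
  than types.\<close>

lemma sum_word_prob_log_card_ge:
  fixes \<mu> :: "'a::finite pmf"
  shows "real n * shannon \<mu> - real CARD('a) * log 2 (real (n + 1))
    \<le> (\<Sum>u\<in>words n. word_prob \<mu> u * log 2 (real (card (perm_class u))))"
proof -
  \<comment> \<open>\<open>T\<close> bounds the number of types, so the weights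
    \<open>1 / (T * card (perm_class u))\<close> sum to at most 1 over all words of length
    \<open>n\<close>.\<close>
  define T where "T = real (n + 1) ^ CARD('a)"
  have T: "T > 0" "log 2 T = real CARD('a) * log 2 (real (n + 1))"
    by (simp_all add: T_def log_nat_power)
  have *: "- (word_prob \<mu> u * log 2 (word_prob \<mu> u)) - word_prob \<mu> u * log 2 T
        - word_prob \<mu> u * log 2 (real (card (perm_class u)))
      \<le> (1 / real (card (perm_class u)) / T - word_prob \<mu> u) / ln 2" (is "?l u \<le> ?r u")
    for u :: "'a list"
  proof (cases "word_prob \<mu> u = 0")
    case True
    then show ?thesis
      using T by simp
  next
    case False
    define p where "p = word_prob \<mu> u"
    define s where "s = real (card (perm_class u))"
    have pos: "p > 0" "s > 0"
      using False word_prob_nonneg[of \<mu> u] card_perm_class_pos[of u] by (auto simp: p_def s_def)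
    have "- log 2 p - log 2 T - log 2 s = ln (1 / (p * T * s)) / ln 2"
      using pos T by (simp add: log_def ln_mult ln_div field_simps)
    \<comment> \<open>This is \<open>ln z \<le> z - 1\<close> at the ratio \<open>z\<close> of the
      comparison weight \<open>1 / (T * s)\<close> to \<open>p\<close>; multiplying by
      \<open>p\<close> makes the right side a difference of two summable weights.\<close>
    also have "\<dots> \<le> (1 / (p * T * s) - 1) / ln 2"
      using pos T by (intro divide_right_mono ln_le_minus_one) auto
    finally have "p * (- log 2 p - log 2 T - log 2 s) \<le> p * ((1 / (p * T * s) - 1) / ln 2)"
      using pos by (intro mult_left_mono) auto
    also have "\<dots> = (1 / s / T - p) / ln 2"
      using pos T by (simp add: field_simps)
    finally show ?thesis
      unfolding p_def s_def by (simp add: algebra_simps)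
  qed
  have "sum ?l (words n) \<le> sum ?r (words n)"
    by (intro sum_mono *)
  also have "\<dots> = ((\<Sum>u\<in>words n. 1 / real (card (perm_class (u :: 'a list)))) / T - 1) / ln 2"
    by (simp only: sum_divide_distrib[symmetric] sum_subtractf sum_word_prob)
  \<comment> \<open>The comparison weights have total at most 1, while the word probabilities have
    total exactly 1.\<close>
  also have "\<dots> \<le> 0"
    using sum_inverse_card_perm_class[where 'a = 'a, of n] T
    by (intro divide_nonpos_pos) (auto simp: T_def)
  finally show ?thesis
    by (simp only: sum_subtractf sum_negf sum_word_prob_log sum_distrib_right[symmetric]
        sum_word_prob T(2))
qed

section \<open>Joint law of the blocks and of \<open>\<Delta>\<close>\<close>

text \<open>The events exhaust the space up to a null set, so \<open>f\<close> agrees almost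
  everywhere with a simple function. No prior bound on \<open>f\<close> or integrability is
  required, which suits \<Delta>.\<close>

lemma (in prob_space) expectation_eq_sum_of_partition:
  fixes f :: "'a \<Rightarrow> real"
  assumes W: "finite W"
    and E: "\<And>w. w \<in> W \<Longrightarrow> E w \<in> events" and disj: "disjoint_family_on E W"
    and total: "(\<Sum>w\<in>W. prob (E w)) = 1"
    and f: "f \<in> borel_measurable M" "\<And>w \<omega>. w \<in> W \<Longrightarrow> \<omega> \<in> E w \<Longrightarrow> f \<omega> = g w"
  shows "expectation f = (\<Sum>w\<in>W. prob (E w) * g w)"
proof -
  have "prob (\<Union>w\<in>W. E w) = 1"
    using finite_measure_finite_Union[OF W _ disj] E total by auto
  then have ae: "AE \<omega> in M. \<omega> \<in> (\<Union>w\<in>W. E w)"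
    using E W by (subst prob_eq_1[symmetric]) (auto intro!: sets.finite_UN)
  have "expectation f = expectation (\<lambda>\<omega>. \<Sum>w\<in>W. indicator (E w) \<omega> * g w)"
  proof (rule integral_cong_AE)
    show "AE \<omega> in M. f \<omega> = (\<Sum>w\<in>W. indicator (E w) \<omega> * g w)"
      using ae
    proof eventually_elim
      fix \<omega> assume "\<omega> \<in> (\<Union>w\<in>W. E w)"
      then obtain v where v: "v \<in> W" "\<omega> \<in> E v"
        by auto
      have "indicator (E w) \<omega> * g w = (if w = v then g w else 0)" if "w \<in> W" for w
        using that v disj by (auto simp: disjoint_family_on_def indicator_def)
      then show "f \<omega> = (\<Sum>w\<in>W. indicator (E w) \<omega> * g w)"
        using v W f(2)[OF v] by simp
    qed
  qed (use E f in auto)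
  also have "\<dots> = (\<Sum>w\<in>W. prob (E w) * g w)"
    using E by (subst Bochner_Integration.integral_sum) (auto simp: emeasure_eq_measure)
  finally show ?thesis .
qed

lemma block_eq_iff: "block n x j = u \<longleftrightarrow> length u = n \<and> (\<forall>i<n. x (n * j + i) = u ! i)"
  by (auto simp: block_def list_eq_iff_nth_eq)

text \<open>This reduces the number of hidden symbols used to \<Delta> itself: the counter advances
  by the length of the word read.\<close>

lemma hidden_used_eq: "hidden_used enum n x y d k = d k"
  by (simp add: hidden_used_def Let_def case_prod_unfold)

context prob_space
begin

context
  fixes X :: "nat \<Rightarrow> 'a \<Rightarrow> 'b::finite" and \<mu> :: "'b pmf" and n :: nat
  assumes X_indep: "indep_vars (\<lambda>_. count_space UNIV) X UNIV"
    and X_distr: "\<And>i. distr M (count_space UNIV) (X i) = measure_pmf \<mu>"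
    and n_pos: "n > 0"
begin

lemma measurable_letter [measurable]: "X i \<in> measurable M (count_space UNIV)"
  using X_indep by (auto simp: indep_vars_def)

lemma prob_letter: "prob (X i -` {a} \<inter> space M) = pmf \<mu> a"
  by (subst measure_distr[symmetric, where N = "count_space UNIV"])
     (auto simp: X_distr measure_pmf_single measurable_letter)

text \<open>The blocks occupy disjoint index ranges, so prescribing \<open>K\<close> of them
  prescribes the first \<open>K * n\<close> letters. Independence gives a product over letters,
  which is regrouped block by block.\<close>

lemma prob_blocks:
  assumes len: "\<And>j. j < K \<Longrightarrow> length (u j) = n"
  shows "\<P>(\<omega> in M. \<forall>j<K. block n (\<lambda>i. X i \<omega>) j = u j) = (\<Prod>j<K. word_prob \<mu> (u j))"
\<comment> \<open>The product formula for independent variables is applied to a nonempty index set,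
  so the case without blocks is separate.\<close>
proof (cases "K = 0")
  case True
  then show ?thesis
    by (simp add: prob_space)
next
  case False
  \<comment> \<open>The prescribed blocks, concatenated into one sequence of letters.\<close>
  define a where "a i = u (i div n) ! (i mod n)" for i
  have "(\<forall>j<K. block n x j = u j) \<longleftrightarrow> (\<forall>i<K * n. x i = a i)" for x
  proof safe
    fix i assume *: "\<forall>j<K. block n x j = u j" "i < K * n"
    then have "i div n < K" "i mod n < n" "n * (i div n) + i mod n = i"
      using n_pos by (auto simp: less_mult_imp_div_less)
    with * show "x i = a i"
      unfolding block_eq_iff a_def by metis
  next
    fix j assume *: "\<forall>i<K * n. x i = a i" "j < K"
    have "n * j + i < K * n" if "i < n" for i
    proof -
      have "n * j + i < n * Suc j"
        using that by simp
      also have "\<dots> \<le> n * K"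
        using *(2) by (intro mult_le_mono2) simp
      finally show ?thesis
        by (simp add: mult.commute)
    qed
    with * show "block n x j = u j"
      by (auto simp: block_eq_iff len a_def)
  qed
  moreover have "{..<K * n} \<noteq> {}"
    using False n_pos by (metis lessThan_iff empty_iff nat_0_less_mult_iff neq0_conv)
  ultimately have "\<P>(\<omega> in M. \<forall>j<K. block n (\<lambda>i. X i \<omega>) j = u j)
      = prob (\<Inter>i\<in>{..<K * n}. X i -` {a i} \<inter> space M)"
    by (intro arg_cong[where f = prob]) auto
  also have "\<dots> = (\<Prod>i<K * n. pmf \<mu> (a i))"
    using False n_pos by (subst indep_varsD[OF X_indep]) (auto simp: prob_letter lessThan_empty_iff)
  also have "\<dots> = (\<Prod>j<K. \<Prod>i\<in>{j * n..<j * n + n}. pmf \<mu> (a i))"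
    by (rule prod.nat_group[symmetric])
  also have "\<dots> = (\<Prod>j<K. word_prob \<mu> (u j))"
  proof (intro prod.cong refl)
    fix j assume "j \<in> {..<K}"
    have "(\<Prod>i\<in>{j * n..<j * n + n}. pmf \<mu> (a i)) = (\<Prod>i<n. pmf \<mu> (a (i + j * n)))"
      using prod.shift_bounds_nat_ivl[of "\<lambda>i. pmf \<mu> (a i)" 0 "j * n" n]
      by (simp add: atLeast0LessThan add.commute)
    also have "\<dots> = word_prob \<mu> (u j)"
      using \<open>j \<in> {..<K}\<close> by (simp add: word_prob_eq_prod len a_def)
    finally show "(\<Prod>i\<in>{j * n..<j * n + n}. pmf \<mu> (a i)) = word_prob \<mu> (u j)" .
  qed
  finally show ?thesis .
qed

text \<open>\<open>steg_delta\<close> gives the law of \<Delta> jointly for an initial segment of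
  blocks. Hence the joint law up to index \<open>k\<close> is computed first, and the coordinates
  before \<open>k\<close> are then summed out.\<close>

lemma expectation_delta:
  assumes "steg_delta M n X Y D"
  shows "expectation (\<lambda>\<omega>. real (D k \<omega>))
    = (\<Sum>u\<in>words n. word_prob \<mu> u * delta_mean (perm_class u))"
proof -
  have D_meas [measurable]: "D j \<in> measurable M (count_space UNIV)" for j
    using assms by (simp add: steg_delta_def)
  define K where "K = Suc k"
  \<comment> \<open>Possible pairs of a block and a value of \<Delta>. The cutoff at
    \<open>top_exp\<close> loses no mass, since \<open>delta_prob\<close> is 0 beyond it;
    \<open>W\<close> collects the histories of \<open>K\<close> such pairs.\<close>
  define B where "B = (SIGMA u:words n. {..top_exp (perm_class (u :: 'b list))})"
  define W where "W = PiE {..<K} (\<lambda>_. B)"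
  define q where "q v = word_prob \<mu> (fst v) * delta_prob (perm_class (fst v)) (snd v)"
    for v :: "'b list \<times> nat"
  define E where "E w = {\<omega> \<in> space M. (\<forall>j<K. D j \<omega> = snd (w j)) \<and>
      (\<forall>j<K. block n (\<lambda>i. X i \<omega>) j = fst (w j))}" for w :: "nat \<Rightarrow> 'b list \<times> nat"
  have finB: "finite B"
    by (simp add: B_def finite_words)
  have sumB: "(\<Sum>v\<in>B. g (fst v) (snd v)) = (\<Sum>u\<in>words n. \<Sum>d\<le>top_exp (perm_class u). g u d)"
    for g :: "'b list \<Rightarrow> nat \<Rightarrow> real"
    by (simp add: B_def sum.Sigma finite_words case_prod_unfold)
  have q_total: "sum q B = 1"
    unfolding q_def
    by (subst sumB) (simp add: sum_distrib_left[symmetric] sum_delta_prob card_perm_class_pos sum_word_prob)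
  have q_mean: "(\<Sum>v\<in>B. q v * real (snd v)) = (\<Sum>u\<in>words n. word_prob \<mu> u * delta_mean (perm_class u))"
    unfolding q_def by (subst sumB) (simp add: delta_mean_def sum_distrib_left mult.assoc)
  have sumW: "(\<Sum>w\<in>W. \<Prod>j<K. f j (w j)) = (\<Prod>j<K. sum (f j) B)"
    for f :: "nat \<Rightarrow> 'b list \<times> nat \<Rightarrow> real"
    unfolding W_def using finB by (subst prod_sum_PiE) auto
  have len: "length (fst (w j)) = n" if "w \<in> W" "j < K" for w j
    using that by (auto simp: W_def B_def words_def dest!: PiE_mem[where x = j])
  have prob_E: "prob (E w) = (\<Prod>j<K. q (w j))" if w: "w \<in> W" for w
  proof -
    define Q where "Q = \<P>(\<omega> in M. \<forall>j<K. block n (\<lambda>i. X i \<omega>) j = fst (w j))"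
    have Q: "Q = (\<Prod>j<K. word_prob \<mu> (fst (w j)))"
      unfolding Q_def using len[OF w] by (rule prob_blocks)
    have "prob (E w) = Q * (\<Prod>j<K. delta_prob (perm_class (fst (w j))) (snd (w j)))"
    proof (cases "Q = 0")
      case True
      have "prob (E w) \<le> Q"
        unfolding Q_def E_def by (rule finite_measure_mono) (auto simp: block_eq_iff)
      with True show ?thesis
        by (simp add: measure_le_0_iff)
    next
      case False
      \<comment> \<open>Taking the full space as the event for the hidden text turns its factor into
        1.\<close>
      have "UNIV \<in> sets (PiM UNIV (\<lambda>_. count_space UNIV) :: (nat \<Rightarrow> bool) measure)"
        using sets.top[of "PiM UNIV (\<lambda>_. count_space UNIV) :: (nat \<Rightarrow> bool) measure"]
        by (simp add: space_PiM)
      with assms False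
      have "\<P>(\<omega> in M. (\<forall>j<K. D j \<omega> = snd (w j)) \<and> (\<lambda>i. Y i \<omega>) \<in> UNIV
              \<bar> \<forall>j<K. block n (\<lambda>i. X i \<omega>) j = fst (w j))
          = (\<Prod>j<K. delta_prob (perm_class (fst (w j))) (snd (w j))) * \<P>(\<omega> in M. (\<lambda>i. Y i \<omega>) \<in> UNIV)"
        unfolding steg_delta_def Q_def by (elim conjE allE ballE impE) auto
      then show ?thesis
        using False by (simp add: cond_prob_def E_def Q_def prob_space field_simps)
    qed
    then show ?thesis
      by (simp add: Q q_def prod.distrib)
  qed
  have "expectation (\<lambda>\<omega>. real (D k \<omega>)) = (\<Sum>w\<in>W. prob (E w) * real (snd (w k)))"
  proof (rule expectation_eq_sum_of_partition)
    show "finite W"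
      unfolding W_def using finB by (intro finite_PiE) auto
    show "E w \<in> events" for w
      unfolding E_def block_eq_iff by measurable
    show "disjoint_family_on E W"
    proof (unfold disjoint_family_on_def, intro ballI impI equals0I)
      fix w w' \<omega>
      assume *: "w \<in> W" "w' \<in> W" "w \<noteq> w'" "\<omega> \<in> E w \<inter> E w'"
      then have "w j = w' j" if "j < K" for j
        using that by (auto simp: E_def prod_eq_iff)
      then have "w = w'"
        using * by (intro PiE_ext[of w "{..<K}" "\<lambda>_. B" w']) (auto simp: W_def)
      with * show False
        by simp
    qed
    \<comment> \<open>The total factors into \<open>K\<close> copies of \<open>sum q B = 1\<close>,
      so histories outside \<open>W\<close> have probability 0.\<close>
    show "(\<Sum>w\<in>W. prob (E w)) = 1"
      using sumW[of "\<lambda>_. q"] by (simp add: prob_E q_total)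
  qed (auto simp: E_def K_def)
  \<comment> \<open>Writing the value at \<open>k\<close> as a product with factor 1 elsewhere lets
    the sum over histories factor again; every factor except the one at \<open>k\<close> is
    1.\<close>
  also have "\<dots> = (\<Sum>w\<in>W. \<Prod>j<K. q (w j) * (if j = k then real (snd (w j)) else 1))"
    by (intro sum.cong refl) (simp add: prob_E prod.distrib K_def)
  also have "\<dots> = (\<Prod>j<K. \<Sum>v\<in>B. q v * (if j = k then real (snd v) else 1))"
    by (rule sumW)
  also have "\<dots> = (\<Sum>v\<in>B. q v * real (snd v))"
    by (simp add: K_def q_total)
  finally show ?thesis
    unfolding q_mean .
qed

end

end

section \<open>Passage to the limit\<close>

theorem corollary1:
  fixes \<mu> :: "'a::finite pmf"
    and M :: "'w measure"
    and X :: "nat \<Rightarrow> 'w \<Rightarrow> 'a"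
    and Y :: "nat \<Rightarrow> 'w \<Rightarrow> bool"
    and D :: "nat \<Rightarrow> nat \<Rightarrow> 'w \<Rightarrow> nat"
    and enum :: "'a list set \<Rightarrow> nat \<Rightarrow> 'a list"
    and k :: nat
  assumes "prob_space M"
    and X_indep: "prob_space.indep_vars M (\<lambda>_. count_space UNIV) X UNIV"
    and X_distr: "\<And>i. distr M (count_space UNIV) (X i) = measure_pmf \<mu>"
    and Y_indep: "prob_space.indep_vars M (\<lambda>_. count_space UNIV) Y UNIV"
    and Y_distr: "\<And>i. distr M (count_space UNIV) (Y i) = measure_pmf (pmf_of_set UNIV)"
    and XY_indep: "prob_space.indep_set M
          (sets (vimage_algebra (space M) (\<lambda>\<omega> i. X i \<omega>) (PiM UNIV (\<lambda>_. count_space UNIV))))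
          (sets (vimage_algebra (space M) (\<lambda>\<omega> i. Y i \<omega>) (PiM UNIV (\<lambda>_. count_space UNIV))))"
    and enum: "\<And>u. bij_betw (enum (perm_class u)) {..<card (perm_class u)} (perm_class u)"
    and delta: "\<And>n. n > 1 \<Longrightarrow> steg_delta M n X Y (D n)"
  shows "(\<lambda>n. avg_hidden M enum n X Y (D n) k) \<longlonglongrightarrow> shannon \<mu>"
proof -
  interpret prob_space M
    by fact
  define c where "c = real CARD('a)"
  define G where "G n = (\<Sum>u\<in>words n. word_prob \<mu> u * delta_mean (perm_class u))" for n
  have avg: "avg_hidden M enum n X Y (D n) k = G n / real n" if "n > 1" for n
    unfolding avg_hidden_def hidden_used_eq G_def
    using expectation_delta[OF X_indep X_distr _ delta[OF that], of k] that by simp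
  have upper: "G n \<le> real n * shannon \<mu>" for n
  proof -
    have "G n \<le> (\<Sum>u\<in>words n. word_prob \<mu> u * log 2 (real (card (perm_class u))))"
      unfolding G_def
      by (intro sum_mono mult_left_mono delta_mean_le_log card_perm_class_pos word_prob_nonneg)
    with sum_word_prob_log_card_le[of \<mu> n] show ?thesis
      by linarith
  qed
  \<comment> \<open>The constant 3 is the error of the mean of \<Delta>; the logarithmic term bounds
    the entropy of the type.\<close>
  have lower: "real n * shannon \<mu> - c * log 2 (real (n + 1)) - 3 \<le> G n" for n
  proof -
    have "(\<Sum>u\<in>words n. word_prob \<mu> u * log 2 (real (card (perm_class u)))) - 3
        = (\<Sum>u\<in>words n. word_prob \<mu> u * (log 2 (real (card (perm_class u))) - 3))"
      by (simp add: right_diff_distrib sum_subtractf sum_distrib_right[symmetric] sum_word_prob)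
    also have "\<dots> \<le> G n"
      unfolding G_def
      by (intro sum_mono mult_left_mono log_le_delta_mean card_perm_class_pos word_prob_nonneg)
    finally show ?thesis
      using sum_word_prob_log_card_ge[of n \<mu>] unfolding c_def by linarith
  qed
  show ?thesis
  \<comment> \<open>After division by \<open>n\<close> the lower error is of order
    \<open>log n / n\<close>. The bounds hold only eventually because the law of \<Delta> is given
    for \<open>n > 1\<close>.\<close>
  proof (rule tendsto_sandwich)
    show "\<forall>\<^sub>F n in sequentially. shannon \<mu> - (c * log 2 (real (n + 1)) + 3) / real n
        \<le> avg_hidden M enum n X Y (D n) k"
      using eventually_gt_at_top[of 1]
    proof eventually_elim
      case (elim n)
      with divide_right_mono[OF lower[of n], of "real n"] show ?case
        by (simp add: avg diff_divide_distrib add_divide_distrib)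
    qed
    show "\<forall>\<^sub>F n in sequentially. avg_hidden M enum n X Y (D n) k \<le> shannon \<mu>"
      using eventually_gt_at_top[of 1]
    proof eventually_elim
      case (elim n)
      with upper[of n] show ?case
        by (simp add: avg field_simps)
    qed
    show "(\<lambda>n. shannon \<mu> - (c * log 2 (real (n + 1)) + 3) / real n) \<longlonglongrightarrow> shannon \<mu>"
      by real_asymp
  qed simp
qed

end
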